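(* Let $X$ be a small category and $\pi:P\to X$ a category over $X$. Let $P{\uparrow}$ be the discrete opfibration over $X$ whose fiber over $x$ is the set $\mathbf{Cat}/X(x/X,P)$ of functors $\xi:x/X\to P$ over $X$, the action of $f:x\to y$ sending $\xi$ to $f\xi:y/X\to P$, the composite of $-\circ f:y/X\to x/X$ with $\xi$. Then the assignment taking any $\xi\in(P{\uparrow})x$ to the object $\xi(x\xrightarrow{\mathrm{id}}x)$ of $P$ over $x$, and any arrow $\langle\xi,x\xrightarrow{f}y\rangle:\xi\to f\xi$ of $P{\uparrow}$ over $f$ to the arrow $\xi(x\xrightarrow{\mathrm{id}}x,\,x\xrightarrow{f}y)$ of $P$ over $f$, is a morphism $\phi_P:P{\uparrow}\to P$ in $\mathbf{Cat}/X$, and it is a universal morphism from a discrete opfibration to $P$: for every discrete opfibration $D$ over $X$ and every morphism $\phi:D\to P$ in $\mathbf{Cat}/X$ there is a unique morphism $\overline{\phi}:D\to P{\uparrow}$ in $\mathbf{Cat}/X$ with $\phi_P\circ\overline{\phi}=\phi$. So the formula $(P{\uparrow})x=\hom(x/X,P)$ gives indeed the coreflection of $P$ in discrete opfibrations.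
   Context: $\mathbf{Cat}/X$ is the slice category: objects ("categories over $X$") are functors $\pi:P\to X$ with $P$ small, morphisms are functors commuting with the projections to $X$; $\hom(P,Q)=\mathbf{Cat}/X(P,Q)$. A category $\pi:D\to X$ over $X$ is a discrete opfibration if for every object $a$ of $D$ and every arrow $f:\pi a\to y$ of $X$ there is a unique arrow of $D$ with domain $a$ lying over $f$; it corresponds to a functor $X\to\mathbf{Set}$, $x\mapsto Dx$ (the fibers), and its arrows over $f:x\to y$ are the pairs $\langle a,f\rangle:a\to fa$ with $a\in Dx$. The coslice $x/X$ has as objects the arrows $h:x\to y$ of $X$ and is a category over $X$ by the codomain functor; each pair of consecutive arrows $x\xrightarrow{h}y\xrightarrow{k}z$ gives an arrow $h\to kh$ of $x/X$ over $k$. For $\xi:x/X\to P$ over $X$, $\xi(x\xrightarrow{h}y)$ denotes its value on the object $h$, and $\xi(x\xrightarrow{h}y,\,y\xrightarrow{k}z):\xi(h)\to\xi(kh)$ its value on the arrow $h\to kh$. *)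

theory Defs
  imports Main "HOL-Library.FuncSet"
begin

text \<open>
  Small categories are given by a set of objects and a set of arrows; \<open>cmp C g f\<close> is the
  composite of \<open>f\<close> followed by \<open>g\<close>, meaningful when \<open>src C g = tgt C f\<close>.
\<close>

record ('o, 'a) cat =
  Ob :: "'o set"
  Ar :: "'a set"
  src :: "'a \<Rightarrow> 'o"
  tgt :: "'a \<Rightarrow> 'o"
  ident :: "'o \<Rightarrow> 'a"
  cmp :: "'a \<Rightarrow> 'a \<Rightarrow> 'a"

locale category =
  fixes C :: "('o, 'a) cat"
  assumes src_in: "f \<in> Ar C \<Longrightarrow> src C f \<in> Ob C"
    and tgt_in: "f \<in> Ar C \<Longrightarrow> tgt C f \<in> Ob C"
    and ident_in: "x \<in> Ob C \<Longrightarrow> ident C x \<in> Ar C"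
    and src_ident: "x \<in> Ob C \<Longrightarrow> src C (ident C x) = x"
    and tgt_ident: "x \<in> Ob C \<Longrightarrow> tgt C (ident C x) = x"
    and cmp_in: "\<lbrakk>f \<in> Ar C; g \<in> Ar C; src C g = tgt C f\<rbrakk> \<Longrightarrow> cmp C g f \<in> Ar C"
    and src_cmp: "\<lbrakk>f \<in> Ar C; g \<in> Ar C; src C g = tgt C f\<rbrakk> \<Longrightarrow> src C (cmp C g f) = src C f"
    and tgt_cmp: "\<lbrakk>f \<in> Ar C; g \<in> Ar C; src C g = tgt C f\<rbrakk> \<Longrightarrow> tgt C (cmp C g f) = tgt C g"
    and cmp_ident_right: "f \<in> Ar C \<Longrightarrow> cmp C f (ident C (src C f)) = f"
    and cmp_ident_left: "f \<in> Ar C \<Longrightarrow> cmp C (ident C (tgt C f)) f = f"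
    and cmp_assoc: "\<lbrakk>f \<in> Ar C; g \<in> Ar C; h \<in> Ar C; src C g = tgt C f; src C h = tgt C g\<rbrakk>
      \<Longrightarrow> cmp C h (cmp C g f) = cmp C (cmp C h g) f"

text \<open>
  Functors are required to be extensional (\<open>undefined\<close> off the objects and arrows of the
  source category), so that equality in HOL is equality of functors.
\<close>

record ('o, 'a, 'p, 'b) ftr =
  omap :: "'o \<Rightarrow> 'p"
  amap :: "'a \<Rightarrow> 'b"

definition is_functor :: "('o, 'a) cat \<Rightarrow> ('p, 'b) cat \<Rightarrow> ('o, 'a, 'p, 'b) ftr \<Rightarrow> bool" where
  "is_functor C D F \<longleftrightarrow>
     category C \<and> category D \<and>
     omap F \<in> Ob C \<rightarrow>\<^sub>E Ob D \<and>
     amap F \<in> Ar C \<rightarrow>\<^sub>E Ar D \<and>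
     (\<forall>f\<in>Ar C. src D (amap F f) = omap F (src C f) \<and> tgt D (amap F f) = omap F (tgt C f)) \<and>
     (\<forall>x\<in>Ob C. amap F (ident C x) = ident D (omap F x)) \<and>
     (\<forall>f\<in>Ar C. \<forall>g\<in>Ar C. src C g = tgt C f \<longrightarrow>
        amap F (cmp C g f) = cmp D (amap F g) (amap F f))"

text \<open>\<open>comp_ftr C G F\<close> is the composite \<open>G \<circ> F\<close>, where \<open>C\<close> is the source of \<open>F\<close>.\<close>

definition comp_ftr ::
  "('o, 'a) cat \<Rightarrow> ('p, 'b, 'q, 'c) ftr \<Rightarrow> ('o, 'a, 'p, 'b) ftr \<Rightarrow> ('o, 'a, 'q, 'c) ftr" where
  "comp_ftr C G F = \<lparr>omap = compose (Ob C) (omap G) (omap F),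
                  amap = compose (Ar C) (amap G) (amap F)\<rparr>"

record ('o, 'a, 'x, 'f) over =
  Tot :: "('o, 'a) cat"
  proj :: "('o, 'a, 'x, 'f) ftr"

definition cat_over :: "('x, 'f) cat \<Rightarrow> ('o, 'a, 'x, 'f) over \<Rightarrow> bool" where
  "cat_over X P \<longleftrightarrow> is_functor (Tot P) X (proj P)"

definition hom_over ::
  "('x, 'f) cat \<Rightarrow> ('o, 'a, 'x, 'f) over \<Rightarrow> ('p, 'b, 'x, 'f) over \<Rightarrow> ('o, 'a, 'p, 'b) ftr set" where
  "hom_over X P Q = {F. cat_over X P \<and> cat_over X Q \<and> is_functor (Tot P) (Tot Q) F \<and>
                        comp_ftr (Tot P) (proj Q) F = proj P}"

definition discrete_opfibration :: "('x, 'f) cat \<Rightarrow> ('o, 'a, 'x, 'f) over \<Rightarrow> bool" where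
  "discrete_opfibration X D \<longleftrightarrow> cat_over X D \<and>
     (\<forall>a\<in>Ob (Tot D). \<forall>f\<in>Ar X. src X f = omap (proj D) a \<longrightarrow>
        (\<exists>!e. e \<in> Ar (Tot D) \<and> src (Tot D) e = a \<and> amap (proj D) e = f))"

text \<open>
  The discrete opfibration corresponding to a set-valued functor on \<open>X\<close> with values \<open>S x\<close>
  and action \<open>act f : S x \<rightarrow> S y\<close> for \<open>f : x \<rightarrow> y\<close>. The object \<open>a \<in> S x\<close> over \<open>x\<close> is encoded as
  \<open>(x, a)\<close>, since the sets \<open>S x\<close> need not be disjoint; the arrow \<open>(a, f)\<close> goes from \<open>a\<close> to
  \<open>act f a\<close> over \<open>f\<close>.
\<close>

definition elements_cat ::
  "('x, 'f) cat \<Rightarrow> ('x \<Rightarrow> 's set) \<Rightarrow> ('f \<Rightarrow> 's \<Rightarrow> 's) \<Rightarrow> ('x \<times> 's, 's \<times> 'f) cat" where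
  "elements_cat X S act =
     \<lparr>Ob = {(x, a). x \<in> Ob X \<and> a \<in> S x},
      Ar = {(a, f). f \<in> Ar X \<and> a \<in> S (src X f)},
      src = (\<lambda>(a, f). (src X f, a)),
      tgt = (\<lambda>(a, f). (tgt X f, act f a)),
      ident = (\<lambda>(x, a). (a, ident X x)),
      cmp = (\<lambda>(b, g) (a, f). (a, cmp X g f))\<rparr>"

definition elements ::
  "('x, 'f) cat \<Rightarrow> ('x \<Rightarrow> 's set) \<Rightarrow> ('f \<Rightarrow> 's \<Rightarrow> 's) \<Rightarrow> ('x \<times> 's, 's \<times> 'f, 'x, 'f) over" where
  "elements X S act =
     \<lparr>Tot = elements_cat X S act,
      proj = \<lparr>omap = restrict fst (Ob (elements_cat X S act)),
              amap = restrict snd (Ar (elements_cat X S act))\<rparr>\<rparr>"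

text \<open>In the coslice, \<open>(h, k)\<close> with \<open>h : x \<rightarrow> y\<close> and \<open>k : y \<rightarrow> z\<close> is the arrow \<open>h \<rightarrow> kh\<close> over \<open>k\<close>.\<close>

definition coslice_cat :: "('x, 'f) cat \<Rightarrow> 'x \<Rightarrow> ('f, 'f \<times> 'f) cat" where
  "coslice_cat X x =
     \<lparr>Ob = {h \<in> Ar X. src X h = x},
      Ar = {(h, k). h \<in> Ar X \<and> src X h = x \<and> k \<in> Ar X \<and> src X k = tgt X h},
      src = (\<lambda>(h, k). h),
      tgt = (\<lambda>(h, k). cmp X k h),
      ident = (\<lambda>h. (h, ident X (tgt X h))),
      cmp = (\<lambda>(h', k') (h, k). (h, cmp X k' k))\<rparr>"

definition coslice :: "('x, 'f) cat \<Rightarrow> 'x \<Rightarrow> ('f, 'f \<times> 'f, 'x, 'f) over" where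
  "coslice X x =
     \<lparr>Tot = coslice_cat X x,
      proj = \<lparr>omap = restrict (tgt X) (Ob (coslice_cat X x)),
              amap = restrict snd (Ar (coslice_cat X x))\<rparr>\<rparr>"

text \<open>For \<open>f : x \<rightarrow> y\<close>, the functor \<open>- \<circ> f : y/X \<rightarrow> x/X\<close>.\<close>

definition precomp :: "('x, 'f) cat \<Rightarrow> 'f \<Rightarrow> ('f, 'f \<times> 'f, 'f, 'f \<times> 'f) ftr" where
  "precomp X f =
     \<lparr>omap = (\<lambda>h\<in>Ob (coslice_cat X (tgt X f)). cmp X h f),
      amap = (\<lambda>(h, k)\<in>Ar (coslice_cat X (tgt X f)). (cmp X h f, k))\<rparr>"

text \<open>\<open>up X P\<close> is \<open>P\<up>\<close>, and \<open>up_counit X P\<close> is \<open>\<phi>\<^sub>P : P\<up> \<rightarrow> P\<close>.\<close>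

definition up ::
  "('x, 'f) cat \<Rightarrow> ('o, 'a, 'x, 'f) over \<Rightarrow>
   ('x \<times> ('f, 'f \<times> 'f, 'o, 'a) ftr, ('f, 'f \<times> 'f, 'o, 'a) ftr \<times> 'f, 'x, 'f) over" where
  "up X P = elements X
     (\<lambda>x. hom_over X (coslice X x) P)
     (\<lambda>f \<xi>. comp_ftr (Tot (coslice X (tgt X f))) \<xi> (precomp X f))"

definition up_counit ::
  "('x, 'f) cat \<Rightarrow> ('o, 'a, 'x, 'f) over \<Rightarrow>
   ('x \<times> ('f, 'f \<times> 'f, 'o, 'a) ftr, ('f, 'f \<times> 'f, 'o, 'a) ftr \<times> 'f, 'o, 'a) ftr" where
  "up_counit X P =
     \<lparr>omap = (\<lambda>(x, \<xi>)\<in>Ob (Tot (up X P)). omap \<xi> (ident X x)),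
      amap = (\<lambda>(\<xi>, f)\<in>Ar (Tot (up X P)). amap \<xi> (ident X (src X f), f))\<rparr>"

end

(* A functor \<xi> : x/X \<rightarrow> P over X is determined by the values of all its translates h\<xi> at
   identities: \<xi>(h) = (h\<xi>)(id) and \<xi>(h, k) = (h\<xi>)(id, k). If D is a discrete opfibration, every object
   a of D over x extends uniquely to a functor x/X \<rightarrow> D over X sending id to a (namely h \<mapsto> ha), and
   composing it with \<phi> : D \<rightarrow> P gives the value at a of the required morphism D \<rightarrow> P\<up>. *)

theory Submission
  imports Defs
begin

section \<open>Functors and categories over a base\<close>

lemma is_functorD:
  assumes "is_functor C D F"
  shows "category C" "category D"
    "x \<in> Ob C \<Longrightarrow> omap F x \<in> Ob D"
    "f \<in> Ar C \<Longrightarrow> amap F f \<in> Ar D"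
    "f \<in> Ar C \<Longrightarrow> src D (amap F f) = omap F (src C f)"
    "f \<in> Ar C \<Longrightarrow> tgt D (amap F f) = omap F (tgt C f)"
    "x \<in> Ob C \<Longrightarrow> amap F (ident C x) = ident D (omap F x)"
    "\<lbrakk>f \<in> Ar C; g \<in> Ar C; src C g = tgt C f\<rbrakk> \<Longrightarrow> amap F (cmp C g f) = cmp D (amap F g) (amap F f)"
    "omap F \<in> extensional (Ob C)" "amap F \<in> extensional (Ar C)"
  using assms unfolding is_functor_def PiE_def by auto

text \<open>Functors are \<open>undefined\<close> off their carriers, so agreement on the carriers
  already makes the two records equal.\<close>

lemma functor_eqI:
  assumes "is_functor C D F" "is_functor C D' G"
    and "\<And>x. x \<in> Ob C \<Longrightarrow> omap F x = omap G x"
    and "\<And>f. f \<in> Ar C \<Longrightarrow> amap F f = amap G f"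
  shows "F = G"
proof -
  have "omap F = omap G" "amap F = amap G"
    using assms is_functorD(9,10) by (metis extensionalityI)+
  then show ?thesis by (cases F; cases G) simp
qed

lemma omap_comp_ftr [simp]: "x \<in> Ob C \<Longrightarrow> omap (comp_ftr C G F) x = omap G (omap F x)"
  by (simp add: comp_ftr_def compose_def)

lemma amap_comp_ftr [simp]: "f \<in> Ar C \<Longrightarrow> amap (comp_ftr C G F) f = amap G (amap F f)"
  by (simp add: comp_ftr_def compose_def)

lemma is_functor_comp:
  assumes F: "is_functor C D F" and G: "is_functor D E G"
  shows "is_functor C E (comp_ftr C G F)"
proof -
  interpret C: category C using F by (rule is_functorD)
  show ?thesis
    unfolding is_functor_def
    using is_functorD[OF F] is_functorD[OF G]
    by (auto simp: C.src_in C.tgt_in C.ident_in C.cmp_in comp_ftr_def compose_def)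
qed

text \<open>Trades the equation between functors into X for pointwise equations, which simp can
  check. The way back holds because both sides of the equation are extensional functors out of
  \<open>Tot P\<close>.\<close>

lemma hom_over_iff:
  "F \<in> hom_over X P Q \<longleftrightarrow> cat_over X P \<and> cat_over X Q \<and> is_functor (Tot P) (Tot Q) F \<and>
     (\<forall>x\<in>Ob (Tot P). omap (proj Q) (omap F x) = omap (proj P) x) \<and>
     (\<forall>f\<in>Ar (Tot P). amap (proj Q) (amap F f) = amap (proj P) f)"
proof -
  have "comp_ftr (Tot P) (proj Q) F = proj P \<longleftrightarrow>
     (\<forall>x\<in>Ob (Tot P). omap (proj Q) (omap F x) = omap (proj P) x) \<and>
     (\<forall>f\<in>Ar (Tot P). amap (proj Q) (amap F f) = amap (proj P) f)" (is "?L \<longleftrightarrow> ?R")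
    if "cat_over X P" "cat_over X Q" "is_functor (Tot P) (Tot Q) F"
  proof
    assume ?L
    then show ?R by (metis omap_comp_ftr amap_comp_ftr)
  next
    assume R: ?R
    show ?L
      by (rule functor_eqI[OF is_functor_comp[OF that(3) that(2)[unfolded cat_over_def]]
            that(1)[unfolded cat_over_def]]) (simp_all add: R)
  qed
  then show ?thesis unfolding hom_over_def by blast
qed

lemma hom_overD:
  assumes "F \<in> hom_over X P Q"
  shows "cat_over X P" "cat_over X Q" "is_functor (Tot P) (Tot Q) F"
    "x \<in> Ob (Tot P) \<Longrightarrow> omap (proj Q) (omap F x) = omap (proj P) x"
    "f \<in> Ar (Tot P) \<Longrightarrow> amap (proj Q) (amap F f) = amap (proj P) f"
  using assms unfolding hom_over_iff by auto

lemma hom_over_comp: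
  assumes F: "F \<in> hom_over X P Q" and G: "G \<in> hom_over X Q R"
  shows "comp_ftr (Tot P) G F \<in> hom_over X P R"
  unfolding hom_over_iff
  using hom_overD[OF F] hom_overD[OF G] is_functor_comp[OF hom_overD(3)[OF F] hom_overD(3)[OF G]]
    is_functorD(3,4)[OF hom_overD(3)[OF F]]
  by simp

context category
begin

text \<open>Taking the identity at a free x, not at \<open>src C f\<close>, keeps the rule
  applicable once simp has rewritten the source to another term.\<close>

lemma cmp_ident_right_eq: "\<lbrakk>f \<in> Ar C; src C f = x\<rbrakk> \<Longrightarrow> cmp C f (ident C x) = f"
  using cmp_ident_right by blast

lemma cmp_ident_left_eq: "\<lbrakk>f \<in> Ar C; tgt C f = x\<rbrakk> \<Longrightarrow> cmp C (ident C x) f = f"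
  using cmp_ident_left by blast

lemmas cat_simps = src_in tgt_in ident_in src_ident tgt_ident cmp_in src_cmp tgt_cmp
  cmp_ident_right_eq cmp_ident_left_eq cmp_assoc

end

section \<open>Categories of elements\<close>

lemma elements_simps [simp]:
  "Ob (Tot (elements X S act)) = {(x, a). x \<in> Ob X \<and> a \<in> S x}"
  "Ar (Tot (elements X S act)) = {(a, f). f \<in> Ar X \<and> a \<in> S (src X f)}"
  "src (Tot (elements X S act)) (a, f) = (src X f, a)"
  "tgt (Tot (elements X S act)) (a, f) = (tgt X f, act f a)"
  "ident (Tot (elements X S act)) (x, a) = (a, ident X x)"
  "cmp (Tot (elements X S act)) (b, g) (a, f) = (a, cmp X g f)"
  "\<lbrakk>x \<in> Ob X; a \<in> S x\<rbrakk> \<Longrightarrow> omap (proj (elements X S act)) (x, a) = x"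
  "\<lbrakk>f \<in> Ar X; a \<in> S (src X f)\<rbrakk> \<Longrightarrow> amap (proj (elements X S act)) (a, f) = f"
  by (simp_all add: elements_def elements_cat_def)

text \<open>An arrow is literally the pair of its source element and its projection, so (a, f) is
  the only lift of f at a. The laws of the action make the targets of identities and composites come
  out right.\<close>

lemma discrete_opfibration_elements:
  assumes X: "category X"
    and act_in: "\<And>f a. \<lbrakk>f \<in> Ar X; a \<in> S (src X f)\<rbrakk> \<Longrightarrow> act f a \<in> S (tgt X f)"
    and act_ident: "\<And>x a. \<lbrakk>x \<in> Ob X; a \<in> S x\<rbrakk> \<Longrightarrow> act (ident X x) a = a"
    and act_cmp: "\<And>f g a. \<lbrakk>f \<in> Ar X; g \<in> Ar X; src X g = tgt X f; a \<in> S (src X f)\<rbrakk>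
      \<Longrightarrow> act (cmp X g f) a = act g (act f a)"
  shows "discrete_opfibration X (elements X S act)"
proof -
  interpret X: category X by fact
  have "category (Tot (elements X S act))"
    by unfold_locales (auto simp: X.cat_simps act_in act_ident act_cmp)
  \<comment> \<open>The declared simp rules describe \<open>proj\<close> only on the carrier; its
    values elsewhere are read off the raw definition.\<close>
  moreover have "omap (proj (elements X S act)) \<in> extensional (Ob (Tot (elements X S act)))"
    "amap (proj (elements X S act)) \<in> extensional (Ar (Tot (elements X S act)))"
    by (simp_all only: elements_def over.simps ftr.simps restrict_extensional)
  ultimately have over: "cat_over X (elements X S act)"
    unfolding cat_over_def is_functor_def PiE_def
    by (auto simp: X X.cat_simps act_in)
  show ?thesis
    unfolding discrete_opfibration_def
    by (auto simp: over)
qed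

section \<open>Coslices\<close>

lemma coslice_simps [simp]:
  "Ob (Tot (coslice X x)) = {h \<in> Ar X. src X h = x}"
  "Ar (Tot (coslice X x)) = {(h, k). h \<in> Ar X \<and> src X h = x \<and> k \<in> Ar X \<and> src X k = tgt X h}"
  "src (Tot (coslice X x)) (h, k) = h"
  "tgt (Tot (coslice X x)) (h, k) = cmp X k h"
  "ident (Tot (coslice X x)) h = (h, ident X (tgt X h))"
  "cmp (Tot (coslice X x)) (h', k') (h, k) = (h, cmp X k' k)"
  "\<lbrakk>h \<in> Ar X; src X h = x\<rbrakk> \<Longrightarrow> omap (proj (coslice X x)) h = tgt X h"
  "\<lbrakk>h \<in> Ar X; src X h = x; k \<in> Ar X; src X k = tgt X h\<rbrakk>
    \<Longrightarrow> amap (proj (coslice X x)) (h, k) = k"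
  by (simp_all add: coslice_def coslice_cat_def)

lemma precomp_simps [simp]:
  "\<lbrakk>h \<in> Ar X; src X h = tgt X f\<rbrakk> \<Longrightarrow> omap (precomp X f) h = cmp X h f"
  "\<lbrakk>h \<in> Ar X; src X h = tgt X f; k \<in> Ar X; src X k = tgt X h\<rbrakk>
    \<Longrightarrow> amap (precomp X f) (h, k) = (cmp X h f, k)"
  by (simp_all add: precomp_def coslice_cat_def)

context category
begin

text \<open>For x outside \<open>Ob C\<close> this is the empty category over C, so every x is
  covered.\<close>

lemma cat_over_coslice: "cat_over C (coslice C x)"
proof -
  have "category (Tot (coslice C x))"
    by unfold_locales (auto simp: cat_simps)
  moreover have "omap (proj (coslice C x)) \<in> extensional (Ob (Tot (coslice C x)))"
    "amap (proj (coslice C x)) \<in> extensional (Ar (Tot (coslice C x)))"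
    by (simp_all only: coslice_def over.simps ftr.simps restrict_extensional)
  ultimately show ?thesis
    unfolding cat_over_def is_functor_def PiE_def
    by (auto simp: category_axioms cat_simps)
qed

text \<open>Targets match by associativity, k(hf) = (kh)f. The functor lies over C because hf has
  the target of h and k is kept.\<close>

lemma precomp_in_hom_over:
  assumes "f \<in> Ar C"
  shows "precomp C f \<in> hom_over C (coslice C (tgt C f)) (coslice C (src C f))"
proof -
  have "precomp C f \<in> {F. omap F \<in> extensional (Ob (Tot (coslice C (tgt C f))))
      \<and> amap F \<in> extensional (Ar (Tot (coslice C (tgt C f))))}"
    by (simp add: precomp_def coslice_def)
  then have "is_functor (Tot (coslice C (tgt C f))) (Tot (coslice C (src C f))) (precomp C f)"
    using cat_over_coslice[of "src C f"] cat_over_coslice[of "tgt C f"] assms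
    \<comment> \<open>Unfolding for \<open>precomp C f\<close> alone leaves the two projections
      folded, so that \<open>is_functorD(1)\<close> can extract from them that both coslices are
      categories.\<close>
    unfolding cat_over_def is_functor_def[of _ _ "precomp C f"] PiE_def
    by (auto dest: is_functorD(1) simp: cat_simps)
  then show ?thesis
    using assms unfolding hom_over_iff
    by (auto simp: cat_over_coslice cat_simps)
qed

end

section \<open>The discrete opfibration of functors from coslices\<close>

text \<open>Names the action f\<xi> written out inside \<open>up\<close>, so that its values get
  simp rules of their own.\<close>

definition translate ::
  "('x, 'f) cat \<Rightarrow> 'f \<Rightarrow> ('f, 'f \<times> 'f, 'o, 'a) ftr \<Rightarrow> ('f, 'f \<times> 'f, 'o, 'a) ftr" where
  "translate X f \<xi> = comp_ftr (Tot (coslice X (tgt X f))) \<xi> (precomp X f)"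

lemma translate_simps [simp]:
  "\<lbrakk>h \<in> Ar X; src X h = tgt X f\<rbrakk> \<Longrightarrow> omap (translate X f \<xi>) h = omap \<xi> (cmp X h f)"
  "\<lbrakk>h \<in> Ar X; src X h = tgt X f; k \<in> Ar X; src X k = tgt X h\<rbrakk>
    \<Longrightarrow> amap (translate X f \<xi>) (h, k) = amap \<xi> (cmp X h f, k)"
  by (simp_all add: translate_def)

lemma up_eq_elements: "up X P = elements X (\<lambda>x. hom_over X (coslice X x) P) (translate X)"
  by (simp only: up_def translate_def[abs_def])

lemma up_counit_simps [simp]:
  "\<lbrakk>x \<in> Ob X; \<xi> \<in> hom_over X (coslice X x) P\<rbrakk>
    \<Longrightarrow> omap (up_counit X P) (x, \<xi>) = omap \<xi> (ident X x)"
  "\<lbrakk>f \<in> Ar X; \<xi> \<in> hom_over X (coslice X (src X f)) P\<rbrakk>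
    \<Longrightarrow> amap (up_counit X P) (\<xi>, f) = amap \<xi> (ident X (src X f), f)"
  by (simp_all add: up_counit_def up_eq_elements)

lemma coslice_hom_eqI:
  assumes "\<xi> \<in> hom_over X (coslice X x) P" "\<zeta> \<in> hom_over X (coslice X x) P"
    and "\<And>h. \<lbrakk>h \<in> Ar X; src X h = x\<rbrakk> \<Longrightarrow> omap \<xi> h = omap \<zeta> h"
    and "\<And>h k. \<lbrakk>h \<in> Ar X; src X h = x; k \<in> Ar X; src X k = tgt X h\<rbrakk>
      \<Longrightarrow> amap \<xi> (h, k) = amap \<zeta> (h, k)"
  shows "\<xi> = \<zeta>"
  by (rule functor_eqI[OF hom_overD(3)[OF assms(1)] hom_overD(3)[OF assms(2)]])
    (auto simp: assms(3,4))

context category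
begin

lemma translate_in_hom_over:
  "\<lbrakk>f \<in> Ar C; \<xi> \<in> hom_over C (coslice C (src C f)) P\<rbrakk>
    \<Longrightarrow> translate C f \<xi> \<in> hom_over C (coslice C (tgt C f)) P"
  unfolding translate_def by (rule hom_over_comp[OF precomp_in_hom_over])

lemma translate_ident:
  assumes "x \<in> Ob C" "\<xi> \<in> hom_over C (coslice C x) P"
  shows "translate C (ident C x) \<xi> = \<xi>"
  using translate_in_hom_over[of "ident C x" \<xi> P] assms
  by (intro coslice_hom_eqI[of _ C x P]) (auto simp: cat_simps)

text \<open>By associativity, both sides send h to \<xi>(hgf), and an arrow (h, k) to \<xi>(hgf,
  k).\<close>

lemma translate_cmp:
  assumes "f \<in> Ar C" "g \<in> Ar C" "src C g = tgt C f" "\<xi> \<in> hom_over C (coslice C (src C f)) P"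
  shows "translate C (cmp C g f) \<xi> = translate C g (translate C f \<xi>)"
  using translate_in_hom_over[of "cmp C g f" \<xi> P] translate_in_hom_over[of f \<xi> P]
    translate_in_hom_over[of g "translate C f \<xi>" P] assms
  by (intro coslice_hom_eqI[of _ C "tgt C g" P]) (auto simp: cat_simps)

lemma discrete_opfibration_up: "discrete_opfibration C (up C P)"
  unfolding up_eq_elements
  by (rule discrete_opfibration_elements)
    (auto simp: category_axioms intro: translate_in_hom_over translate_ident translate_cmp)

text \<open>The arrow \<xi>(id, f) runs from \<xi>(id) to \<xi>(f), and \<xi>(f) is the value of
  f\<xi> at the identity, hence the counit at the target.\<close>

lemma up_counit_in_hom_over:
  assumes P: "cat_over C P"
  shows "up_counit C P \<in> hom_over C (up C P) P"
proof -
  have up: "cat_over C (up C P)"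
    using discrete_opfibration_up unfolding discrete_opfibration_def by blast
  have ob: "omap \<xi> h \<in> Ob (Tot P)" "omap (proj P) (omap \<xi> h) = tgt C h"
    if "h \<in> Ar C" "\<xi> \<in> hom_over C (coslice C (src C h)) P" for \<xi> h
    using is_functorD(3)[OF hom_overD(3)[OF that(2)], of h] hom_overD(4)[OF that(2), of h] that(1)
    by simp_all
  have ar: "amap \<xi> (h, k) \<in> Ar (Tot P)" "amap (proj P) (amap \<xi> (h, k)) = k"
    "src (Tot P) (amap \<xi> (h, k)) = omap \<xi> h" "tgt (Tot P) (amap \<xi> (h, k)) = omap \<xi> (cmp C k h)"
    if "h \<in> Ar C" "k \<in> Ar C" "src C k = tgt C h" "\<xi> \<in> hom_over C (coslice C (src C h)) P" for \<xi> h k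
    using is_functorD(4-6)[OF hom_overD(3)[OF that(4)], of "(h, k)"]
      hom_overD(5)[OF that(4), of "(h, k)"] that(1-3)
    by simp_all
  \<comment> \<open>In the coslice, the identity of the object \<open>ident C x\<close> is the pair
    of \<open>ident C x\<close> with itself.\<close>
  have id: "amap \<xi> (ident C x, ident C x) = ident (Tot P) (omap \<xi> (ident C x))"
    if "x \<in> Ob C" "\<xi> \<in> hom_over C (coslice C x) P" for \<xi> x
    using is_functorD(7)[OF hom_overD(3)[OF that(2)], of "ident C x"] that(1)
    by (simp add: cat_simps)
  \<comment> \<open>In the coslice, h to lkh factors through kh. With h an identity this is
    functoriality of the counit, as \<xi>(k, l) is the value of k\<xi> at (id, l).\<close>
  have cm: "amap \<xi> (h, cmp C l k) = cmp (Tot P) (amap \<xi> (cmp C k h, l)) (amap \<xi> (h, k))"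
    if "h \<in> Ar C" "k \<in> Ar C" "src C k = tgt C h" "l \<in> Ar C" "src C l = tgt C k"
      "\<xi> \<in> hom_over C (coslice C (src C h)) P" for \<xi> h k l
    using is_functorD(8)[OF hom_overD(3)[OF that(6)], of "(h, k)" "(cmp C k h, l)"] that(1-5)
    by (simp add: cat_simps)
  have ext: "omap (up_counit C P) \<in> extensional (Ob (Tot (up C P)))"
    "amap (up_counit C P) \<in> extensional (Ar (Tot (up C P)))"
    by (simp_all add: up_counit_def)
  have cats: "category (Tot (up C P))" "category (Tot P)"
    using up P unfolding cat_over_def by (auto dest: is_functorD(1))
  have "omap (up_counit C P) \<in> Ob (Tot (up C P)) \<rightarrow>\<^sub>E Ob (Tot P)"
    using ext unfolding PiE_def by (auto simp: up_eq_elements cat_simps ob)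
  moreover have "amap (up_counit C P) \<in> Ar (Tot (up C P)) \<rightarrow>\<^sub>E Ar (Tot P)"
    using ext unfolding PiE_def by (auto simp: up_eq_elements cat_simps ar)
  moreover have "\<forall>a\<in>Ar (Tot (up C P)).
      src (Tot P) (amap (up_counit C P) a) = omap (up_counit C P) (src (Tot (up C P)) a) \<and>
      tgt (Tot P) (amap (up_counit C P) a) = omap (up_counit C P) (tgt (Tot (up C P)) a)"
    by (auto simp: up_eq_elements cat_simps ar translate_in_hom_over)
  moreover have "\<forall>a\<in>Ob (Tot (up C P)).
      amap (up_counit C P) (ident (Tot (up C P)) a) = ident (Tot P) (omap (up_counit C P) a)"
    by (auto simp: up_eq_elements cat_simps id)
  moreover have "\<forall>a\<in>Ar (Tot (up C P)). \<forall>b\<in>Ar (Tot (up C P)).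
      src (Tot (up C P)) b = tgt (Tot (up C P)) a \<longrightarrow>
      amap (up_counit C P) (cmp (Tot (up C P)) b a) =
      cmp (Tot P) (amap (up_counit C P) b) (amap (up_counit C P) a)"
    by (auto simp: up_eq_elements cat_simps cm translate_in_hom_over)
  ultimately have "is_functor (Tot (up C P)) (Tot P) (up_counit C P)"
    unfolding is_functor_def using cats by blast
  then show ?thesis
    unfolding hom_over_iff using up P
    by (auto simp: up_eq_elements cat_simps ob ar)
qed

end

section \<open>Lifts in a discrete opfibration\<close>

locale discrete_opfib = X: category X
  for X :: "('x, 'f) cat" and D :: "('d, 'e, 'x, 'f) over" +
  assumes dopf: "discrete_opfibration X D"
begin

abbreviation "T \<equiv> Tot D"
abbreviation "p \<equiv> omap (proj D)"
abbreviation "q \<equiv> amap (proj D)"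

lemma over: "cat_over X D"
  using dopf by (simp add: discrete_opfibration_def)

sublocale T: category T
  using over unfolding cat_over_def by (rule is_functorD)

lemmas proj_functor = is_functorD(3-8)[OF over[unfolded cat_over_def]]

text \<open>This is the arrow <a, f> from a to fa; accordingly \<open>tgt T (lift a f)\<close>
  serves as the action fa throughout.\<close>

definition lift :: "'d \<Rightarrow> 'f \<Rightarrow> 'e" where
  "lift a f = (THE e. e \<in> Ar T \<and> src T e = a \<and> q e = f)"

lemma
  assumes "a \<in> Ob T" "f \<in> Ar X" "src X f = p a"
  shows lift_in: "lift a f \<in> Ar T" and src_lift: "src T (lift a f) = a"
    and q_lift: "q (lift a f) = f"
  using theI'[of "\<lambda>e. e \<in> Ar T \<and> src T e = a \<and> q e = f"] dopf assms
  unfolding lift_def discrete_opfibration_def by blast+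

text \<open>The uniqueness half of the lifting property: an arrow of D is recovered from its source
  and projection, which reduces equations between arrows to those two data.\<close>

lemma lift_unique:
  assumes "e \<in> Ar T"
  shows "lift (src T e) (q e) = e"
  unfolding lift_def
proof (rule the1_equality)
  show "\<exists>!e'. e' \<in> Ar T \<and> src T e' = src T e \<and> q e' = q e"
    using dopf assms unfolding discrete_opfibration_def
    by (simp add: T.cat_simps proj_functor)
qed (use assms in simp)

lemma
  assumes "a \<in> Ob T" "f \<in> Ar X" "src X f = p a"
  shows tgt_lift_in: "tgt T (lift a f) \<in> Ob T" and p_tgt_lift: "p (tgt T (lift a f)) = tgt X f"
  using assms lift_in[OF assms] q_lift[OF assms] proj_functor(4)[of "lift a f"]
  by (simp_all add: T.cat_simps)

lemma lift_ident:
  assumes "a \<in> Ob T"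
  shows "lift a (ident X (p a)) = ident T a"
  using lift_unique[of "ident T a"] assms by (simp add: T.cat_simps proj_functor)

text \<open>The right-hand side starts at a and lies over gf, so it is the lift of gf.\<close>

lemma lift_cmp:
  assumes "a \<in> Ob T" "f \<in> Ar X" "src X f = p a" "g \<in> Ar X" "src X g = tgt X f"
  shows "lift a (cmp X g f) = cmp T (lift (tgt T (lift a f)) g) (lift a f)"
  using lift_unique[of "cmp T (lift (tgt T (lift a f)) g) (lift a f)"] assms
  by (simp add: T.cat_simps proj_functor lift_in src_lift q_lift tgt_lift_in p_tgt_lift)

text \<open>The action law (gf)a = g(fa).\<close>

lemma tgt_lift_cmp:
  assumes "a \<in> Ob T" "f \<in> Ar X" "src X f = p a" "g \<in> Ar X" "src X g = tgt X f"
  shows "tgt T (lift a (cmp X g f)) = tgt T (lift (tgt T (lift a f)) g)"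
  using assms by (simp add: lift_cmp T.cat_simps lift_in src_lift tgt_lift_in p_tgt_lift)

text \<open>The functor from the coslice corresponding to a in the manner of Yoneda: h goes to ha,
  and (h, k) to <ha, k>.\<close>

definition orbit :: "'d \<Rightarrow> ('f, 'f \<times> 'f, 'd, 'e) ftr" where
  "orbit a = \<lparr>omap = (\<lambda>h\<in>Ob (Tot (coslice X (p a))). tgt T (lift a h)),
              amap = (\<lambda>(h, k)\<in>Ar (Tot (coslice X (p a))). lift (tgt T (lift a h)) k)\<rparr>"

lemma orbit_simps [simp]:
  "\<lbrakk>h \<in> Ar X; src X h = p a\<rbrakk> \<Longrightarrow> omap (orbit a) h = tgt T (lift a h)"
  "\<lbrakk>h \<in> Ar X; src X h = p a; k \<in> Ar X; src X k = tgt X h\<rbrakk>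
    \<Longrightarrow> amap (orbit a) (h, k) = lift (tgt T (lift a h)) k"
  by (simp_all add: orbit_def)

text \<open>The lift <ha, k> ends at k(ha) = (kh)a, as a functor requires; composites are preserved
  by uniqueness of lifts.\<close>

lemma orbit_in_hom_over:
  assumes a: "a \<in> Ob T"
  shows "orbit a \<in> hom_over X (coslice X (p a)) D"
proof -
  have ext: "omap (orbit a) \<in> extensional (Ob (Tot (coslice X (p a))))"
    "amap (orbit a) \<in> extensional (Ar (Tot (coslice X (p a))))"
    by (simp_all only: orbit_def ftr.simps restrict_extensional)
  have cat: "category (Tot (coslice X (p a)))"
    using X.cat_over_coslice unfolding cat_over_def by (rule is_functorD(1))
  have ident: "lift (tgt T (lift a h)) (ident X (tgt X h)) = ident T (tgt T (lift a h))"
    if "h \<in> Ar X" "src X h = p a" for h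
    using lift_ident[of "tgt T (lift a h)"] a that by (simp add: tgt_lift_in p_tgt_lift)
  have "is_functor (Tot (coslice X (p a))) T (orbit a)"
    unfolding is_functor_def PiE_def using ext cat a
    \<comment> \<open>\<open>lift_cmp\<close> is instantiated at points ha, for composites of
      coslice arrows; targets of lifts of composites from a itself are left to
      \<open>tgt_lift_cmp\<close>.\<close>
    by (auto simp: T.category_axioms X.cat_simps lift_in src_lift tgt_lift_in p_tgt_lift ident
        tgt_lift_cmp lift_cmp[of "tgt T (lift a _)"])
  then show ?thesis
    unfolding hom_over_iff using a
    by (auto simp: X.cat_over_coslice over q_lift tgt_lift_in p_tgt_lift)
qed

section \<open>The universal property\<close>

text \<open>The arrow part is forced by the object part, since an arrow of \<open>up X P\<close>
  consists of its source element and its projection.\<close>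

definition transpose ::
  "('d, 'e, 'o, 'a) ftr \<Rightarrow> ('d, 'e, 'x \<times> ('f, 'f \<times> 'f, 'o, 'a) ftr, ('f, 'f \<times> 'f, 'o, 'a) ftr \<times> 'f) ftr"
  where "transpose \<phi> =
    \<lparr>omap = (\<lambda>a\<in>Ob T. (p a, comp_ftr (Tot (coslice X (p a))) \<phi> (orbit a))),
     amap = (\<lambda>e\<in>Ar T. (comp_ftr (Tot (coslice X (p (src T e)))) \<phi> (orbit (src T e)), q e))\<rparr>"

lemma transpose_in_hom_over:
  assumes \<phi>: "\<phi> \<in> hom_over X D P"
  shows "transpose \<phi> \<in> hom_over X D (up X P)"
proof -
  have up: "cat_over X (up X P)"
    using X.discrete_opfibration_up unfolding discrete_opfibration_def by blast
  then have cat: "category (Tot (up X P))"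
    unfolding cat_over_def by (rule is_functorD(1))
  let ?\<xi> = "\<lambda>a. comp_ftr (Tot (coslice X (p a))) \<phi> (orbit a)"
  have \<xi>: "?\<xi> a \<in> hom_over X (coslice X (p a)) P" if "a \<in> Ob T" for a
    using hom_over_comp[OF orbit_in_hom_over[OF that] \<phi>] .
  \<comment> \<open>Naturality in a: for e from a to fa over f, both sides send h to the value of
    \<phi> at (hf)a = h(fa). \<open>lift_unique\<close> identifies e with the lift of
    \<open>q e\<close>.\<close>
  have tr: "translate X (q e) (?\<xi> (src T e)) = ?\<xi> (tgt T e)" if "e \<in> Ar T" for e
  proof (rule coslice_hom_eqI)
    have e: "src T e \<in> Ob T" "tgt T e \<in> Ob T" "q e \<in> Ar X"
      "src X (q e) = p (src T e)" "tgt X (q e) = p (tgt T e)"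
      using that by (simp_all add: T.cat_simps proj_functor)
    show "translate X (q e) (?\<xi> (src T e)) \<in> hom_over X (coslice X (p (tgt T e))) P"
      using X.translate_in_hom_over[of "q e" "?\<xi> (src T e)" P] \<xi> e by simp
    show "?\<xi> (tgt T e) \<in> hom_over X (coslice X (p (tgt T e))) P"
      using \<xi> e by simp
  qed (use that in \<open>simp_all add: T.cat_simps X.cat_simps proj_functor tgt_lift_cmp lift_unique\<close>)
  have "is_functor T (Tot (up X P)) (transpose \<phi>)"
    unfolding is_functor_def using cat \<xi> tr
    by (auto simp: T.category_axioms transpose_def up_eq_elements T.cat_simps proj_functor)
  then show ?thesis
    unfolding hom_over_iff using up over \<xi>
    by (auto simp: transpose_def up_eq_elements T.cat_simps proj_functor)
qed

text \<open>Evaluating the orbit of a at the identity lifts an identity, which gives a back; its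
  value at (id, \<open>q e\<close>) is then the lift of \<open>q e\<close> at the source of e, that
  is e.\<close>

lemma up_counit_transpose:
  assumes \<phi>: "\<phi> \<in> hom_over X D P"
  shows "comp_ftr T (up_counit X P) (transpose \<phi>) = \<phi>"
proof (rule functor_eqI[OF is_functor_comp])
  show "is_functor T (Tot (up X P)) (transpose \<phi>)"
    using transpose_in_hom_over[OF \<phi>] by (rule hom_overD)
  show "is_functor (Tot (up X P)) (Tot P) (up_counit X P)"
    using X.up_counit_in_hom_over hom_overD(2)[OF \<phi>] by (blast dest: hom_overD(3))
  show "is_functor T (Tot P) \<phi>"
    using \<phi> by (rule hom_overD)
  note \<xi> = hom_over_comp[OF orbit_in_hom_over \<phi>]
  show "omap (comp_ftr T (up_counit X P) (transpose \<phi>)) a = omap \<phi> a" if "a \<in> Ob T" for a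
    using that \<xi>[OF that]
    by (simp add: transpose_def proj_functor X.cat_simps T.cat_simps lift_ident)
  show "amap (comp_ftr T (up_counit X P) (transpose \<phi>)) e = amap \<phi> e" if "e \<in> Ar T" for e
    using that \<xi>[of "src T e"]
    by (simp add: transpose_def proj_functor X.cat_simps T.cat_simps lift_ident lift_unique)
qed

text \<open>A morphism into \<open>up X P\<close> amounts to a family of functors \<xi> indexed by
  the objects of D and natural for the action: the functor at fa is the translate by f of the one at
  a. First components and arrow values are forced by the projections and sources.\<close>

lemma hom_to_upD:
  assumes \<psi>: "\<psi> \<in> hom_over X D (up X P)"
  shows "a \<in> Ob T \<Longrightarrow> omap \<psi> a = (p a, snd (omap \<psi> a))"
    and "a \<in> Ob T \<Longrightarrow> snd (omap \<psi> a) \<in> hom_over X (coslice X (p a)) P"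
    and "e \<in> Ar T \<Longrightarrow> amap \<psi> e = (snd (omap \<psi> (src T e)), q e)"
    and "e \<in> Ar T \<Longrightarrow> snd (omap \<psi> (tgt T e)) = translate X (q e) (snd (omap \<psi> (src T e)))"
proof -
  note F = hom_overD(3-5)[OF \<psi>, unfolded up_eq_elements]
  note G = is_functorD(3-6)[OF F(1)]
  show ob: "omap \<psi> a = (p a, snd (omap \<psi> a))"
    "snd (omap \<psi> a) \<in> hom_over X (coslice X (p a)) P" if "a \<in> Ob T" for a
    using F(2)[OF that] G(1)[OF that] by (auto split: prod.splits)
  show "amap \<psi> e = (snd (omap \<psi> (src T e)), q e)"
    "snd (omap \<psi> (tgt T e)) = translate X (q e) (snd (omap \<psi> (src T e)))" if "e \<in> Ar T"
  proof -
    obtain \<xi> f where e: "amap \<psi> e = (\<xi>, f)"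
      by fastforce
    have f: "f = q e"
      using F(3)[OF that] G(2)[OF that] by (simp add: e)
    have src: "(src X f, \<xi>) = omap \<psi> (src T e)" and tgt: "(tgt X f, translate X f \<xi>) = omap \<psi> (tgt T e)"
      using G(3,4)[OF that] by (simp_all add: e)
    show "amap \<psi> e = (snd (omap \<psi> (src T e)), q e)"
      by (simp add: e f flip: src)
    show "snd (omap \<psi> (tgt T e)) = translate X (q e) (snd (omap \<psi> (src T e)))"
      by (simp add: f flip: src tgt)
  qed
qed

text \<open>Evaluation at identities loses nothing: \<psi>(a)(h) = (h\<psi>(a))(id) =
  \<psi>(ha)(id), which is the counit after \<psi> at ha. Arrows (h, k) are recovered likewise from
  <ha, k>.\<close>

lemma hom_to_up_eqI:
  assumes \<psi>: "\<psi> \<in> hom_over X D (up X P)" and \<psi>': "\<psi>' \<in> hom_over X D (up X P)"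
    and eq: "comp_ftr T (up_counit X P) \<psi> = comp_ftr T (up_counit X P) \<psi>'"
  shows "\<psi> = \<psi>'"
proof -
  have val: "omap (snd (omap \<chi> a)) h
        = omap (comp_ftr T (up_counit X P) \<chi>) (tgt T (lift a h))"
      "\<lbrakk>k \<in> Ar X; src X k = tgt X h\<rbrakk> \<Longrightarrow> amap (snd (omap \<chi> a)) (h, k)
        = amap (comp_ftr T (up_counit X P) \<chi>) (lift (tgt T (lift a h)) k)"
    if \<chi>: "\<chi> \<in> hom_over X D (up X P)" and a: "a \<in> Ob T" "h \<in> Ar X" "src X h = p a" for \<chi> a h k
  proof -
    note app = hom_to_upD[OF \<chi>]
    let ?b = "tgt T (lift a h)"
    have b: "?b \<in> Ob T" "p ?b = tgt X h"
      using a by (simp_all add: tgt_lift_in p_tgt_lift)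
    \<comment> \<open>Naturality along the lift of h, whose target is \<open>?b\<close> =
      ha.\<close>
    have tr: "snd (omap \<chi> ?b) = translate X h (snd (omap \<chi> a))"
      using app(4)[OF lift_in[OF a]] a by (simp add: src_lift q_lift)
    \<comment> \<open>\<open>app(1)\<close> displays \<open>omap \<chi> ?b\<close> as a pair, the
      form to which \<open>up_counit_simps(1)\<close> applies.\<close>
    have "omap (up_counit X P) (omap \<chi> ?b) = omap (snd (omap \<chi> ?b)) (ident X (tgt X h))"
      using app(1,2)[OF b(1)] b a by (metis X.tgt_in up_counit_simps(1))
    then show "omap (snd (omap \<chi> a)) h = omap (comp_ftr T (up_counit X P) \<chi>) ?b"
      using a b by (simp add: tr X.cat_simps)
    assume k: "k \<in> Ar X" "src X k = tgt X h"
    then have l: "lift ?b k \<in> Ar T" "src T (lift ?b k) = ?b" "q (lift ?b k) = k"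
      using b by (simp_all add: lift_in src_lift q_lift)
    have "amap (up_counit X P) (amap \<chi> (lift ?b k)) = amap (snd (omap \<chi> ?b)) (ident X (tgt X h), k)"
      using app(3)[OF l(1)] app(2)[OF b(1)] b l k by simp
    then show "amap (snd (omap \<chi> a)) (h, k) = amap (comp_ftr T (up_counit X P) \<chi>) (lift ?b k)"
      using a k l by (simp add: tr X.cat_simps)
  qed
  have snd_eq: "snd (omap \<psi> a) = snd (omap \<psi>' a)" if a: "a \<in> Ob T" for a
    using hom_to_upD(2)[OF \<psi> a] hom_to_upD(2)[OF \<psi>' a]
    by (rule coslice_hom_eqI) (simp_all add: val[OF \<psi> a] val[OF \<psi>' a] eq)
  show ?thesis
  proof (rule functor_eqI[OF hom_overD(3)[OF \<psi>] hom_overD(3)[OF \<psi>']])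
    show "omap \<psi> a = omap \<psi>' a" if "a \<in> Ob T" for a
      using hom_to_upD(1)[OF \<psi> that] hom_to_upD(1)[OF \<psi>' that] snd_eq[OF that] by simp
    show "amap \<psi> e = amap \<psi>' e" if "e \<in> Ar T" for e
      using hom_to_upD(3)[OF \<psi> that] hom_to_upD(3)[OF \<psi>' that] snd_eq[of "src T e"] that
      by (simp add: T.cat_simps)
  qed
qed

end

theorem proposition24:
  fixes X :: "('x, 'f) cat" and P :: "('o, 'a, 'x, 'f) over"
  assumes "category X" and "cat_over X P"
  shows "discrete_opfibration X (up X P) \<and>
    up_counit X P \<in> hom_over X (up X P) P \<and>
    (\<forall>(D :: ('d, 'e, 'x, 'f) over) \<phi>.
       discrete_opfibration X D \<and> \<phi> \<in> hom_over X D P \<longrightarrow>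
       (\<exists>!\<psi>. \<psi> \<in> hom_over X D (up X P) \<and> comp_ftr (Tot D) (up_counit X P) \<psi> = \<phi>))"
proof (intro conjI allI impI)
  show "discrete_opfibration X (up X P)"
    using assms(1) by (rule category.discrete_opfibration_up)
  show "up_counit X P \<in> hom_over X (up X P) P"
    using assms by (rule category.up_counit_in_hom_over)
  fix D :: "('d, 'e, 'x, 'f) over" and \<phi>
  assume *: "discrete_opfibration X D \<and> \<phi> \<in> hom_over X D P"
  then interpret discrete_opfib X D
    by (intro discrete_opfib.intro discrete_opfib_axioms.intro assms(1)) simp
  show "\<exists>!\<psi>. \<psi> \<in> hom_over X D (up X P) \<and> comp_ftr (Tot D) (up_counit X P) \<psi> = \<phi>"
  proof (rule ex1I[of _ "transpose \<phi>"])
    show "transpose \<phi> \<in> hom_over X D (up X P) \<and> comp_ftr T (up_counit X P) (transpose \<phi>) = \<phi>"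
      using * by (simp add: transpose_in_hom_over up_counit_transpose)
    then show "\<psi> = transpose \<phi>"
      if "\<psi> \<in> hom_over X D (up X P) \<and> comp_ftr T (up_counit X P) \<psi> = \<phi>" for \<psi>
      using that hom_to_up_eqI[of \<psi> P "transpose \<phi>"] by simp
  qed
qed

end
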